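(* Let $R$ be a commutative associative unital ring in which $2$ is invertible, let $n>1$ be an integer, and let $M_n(R)$ be the associative ring of $n\times n$ matrices over $R$. Then every 2-local inner derivation $\Delta: M_n(R)\to M_n(R)$ is an inner derivation.
   Context: Let $S$ be an associative ring. An inner derivation of $S$ is a map $D:S\to S$ for which there exists $a\in S$ with $D(x)=ax-xa$ for all $x\in S$. A map $\Delta:S\to S$ (not assumed additive) is called a 2-local inner derivation if for any two elements $x,y\in S$ there exists an element $a\in S$ (depending on $x,y$) such that $\Delta(x)=ax-xa$ and $\Delta(y)=ay-ya$. *)

theory Defs
  imports "Jordan_Normal_Form.Matrix"
begin

definition inner_derivation :: "('s, 'm) ring_scheme \<Rightarrow> ('s \<Rightarrow> 's) \<Rightarrow> bool" where
  "inner_derivation S D \<longleftrightarrow>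
     D \<in> carrier S \<rightarrow> carrier S \<and>
     (\<exists>a\<in>carrier S. \<forall>x\<in>carrier S. D x = a \<otimes>\<^bsub>S\<^esub> x \<ominus>\<^bsub>S\<^esub> x \<otimes>\<^bsub>S\<^esub> a)"

definition two_local_inner_derivation :: "('s, 'm) ring_scheme \<Rightarrow> ('s \<Rightarrow> 's) \<Rightarrow> bool" where
  "two_local_inner_derivation S \<Delta> \<longleftrightarrow>
     \<Delta> \<in> carrier S \<rightarrow> carrier S \<and>
     (\<forall>x\<in>carrier S. \<forall>y\<in>carrier S. \<exists>a\<in>carrier S.
        \<Delta> x = a \<otimes>\<^bsub>S\<^esub> x \<ominus>\<^bsub>S\<^esub> x \<otimes>\<^bsub>S\<^esub> a \<and>
        \<Delta> y = a \<otimes>\<^bsub>S\<^esub> y \<ominus>\<^bsub>S\<^esub> y \<otimes>\<^bsub>S\<^esub> a)"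

text \<open>
  The sort \<open>{comm_ring, comm_monoid_mult}\<close> axiomatises commutative unital rings without
  \<open>0 \<noteq> 1\<close>, so that, unlike with \<open>comm_ring_1\<close>, the zero ring is not excluded. The constant
  \<open>ring_mat\<close> requires \<open>semiring_1\<close>; the following definition is the same ring without that
  requirement.
\<close>

definition matrix_ring :: "nat \<Rightarrow> 'a :: {comm_ring, comm_monoid_mult} mat ring" where
  "matrix_ring n = \<lparr>carrier = carrier_mat n n, mult = (*), one = 1\<^sub>m n, zero = 0\<^sub>m n n, add = (+)\<rparr>"

lemma matrix_ring_simps:
  "carrier (matrix_ring n) = carrier_mat n n"
  "mult (matrix_ring n) = (*)"
  "one (matrix_ring n) = 1\<^sub>m n"
  "zero (matrix_ring n) = 0\<^sub>m n n"
  "add (matrix_ring n) = (+)"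
  by (simp_all add: matrix_ring_def)

lemma matrix_ring_eq_ring_mat:
  "matrix_ring n = ring_mat TYPE('a :: comm_ring_1) n ()"
  by (simp add: matrix_ring_def ring_mat_def)

lemma one_mat_mult:
  fixes A :: "'a :: {comm_ring, comm_monoid_mult} mat"
  assumes A: "A \<in> carrier_mat n n"
  shows "1\<^sub>m n * A = A" "A * 1\<^sub>m n = A"
proof -
  have *: "(if i = k then 1 else 0) * c = (if k = i then c else 0)"
    "c * (if k = j then 1 else 0) = (if k = j then c else 0)" for i j k :: nat and c :: 'a
    by auto
  show "1\<^sub>m n * A = A" "A * 1\<^sub>m n = A"
    using A by (auto intro!: eq_matI simp: scalar_prod_def * sum.delta)
qed

lemma ring_matrix_ring:
  "ring (matrix_ring n :: 'a :: {comm_ring, comm_monoid_mult} mat ring)"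
proof -
  have "\<exists>y\<in>carrier_mat n n. y + x = 0\<^sub>m n n \<and> x + y = 0\<^sub>m n n"
    if "x \<in> carrier_mat n n" for x :: "'a mat"
    using that by (intro bexI[of _ "- x"]) auto
  then show ?thesis
    by unfold_locales
      (auto simp: matrix_ring_simps one_mat_mult add_mult_distrib_mat mult_add_distrib_mat
        assoc_mult_mat[of _ n n _ n _ n] assoc_add_mat[of _ n n] Units_def intro: comm_add_mat[of _ n n])
qed

lemma matrix_ring_minus:
  fixes A B :: "'a :: {comm_ring, comm_monoid_mult} mat"
  assumes A: "A \<in> carrier_mat n n" and B: "B \<in> carrier_mat n n"
  shows "A \<ominus>\<^bsub>matrix_ring n\<^esub> B = A - B"
proof -
  interpret ring "matrix_ring n :: 'a mat ring" by (rule ring_matrix_ring)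
  have "\<ominus>\<^bsub>matrix_ring n\<^esub> B = - B"
    by (rule minus_equality) (use B in \<open>auto simp: matrix_ring_simps\<close>)
  then have "A \<ominus>\<^bsub>matrix_ring n\<^esub> B = A + - B"
    by (simp add: a_minus_def matrix_ring_simps)
  also have "\<dots> = A - B"
    using A B by (auto intro!: eq_matI)
  finally show ?thesis .
qed

end

theory Submission
  imports Defs
begin

text \<open>
  After subtracting an inner derivation, \<open>\<Delta>\<close> kills the diagonal matrix units. Comparing \<open>\<Delta>\<close> at
  an off-diagonal unit \<open>e\<^sub>i\<^sub>j\<close> with \<open>\<Delta>\<close> at \<open>e\<^sub>i\<^sub>i\<close> and at \<open>e\<^sub>j\<^sub>j\<close> then shows that \<open>\<Delta> e\<^sub>i\<^sub>j\<close> is a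
  multiple of \<open>e\<^sub>i\<^sub>j\<close>. Comparing \<open>\<Delta> x\<close> with the values at all matrix units shows that \<open>\<Delta>\<close>
  multiplies the entries \<open>x\<^sub>i\<^sub>j\<close> by constants \<open>c\<^sub>i\<^sub>j\<close>. Comparing \<open>x = e\<^sub>i\<^sub>j + e\<^sub>j\<^sub>k\<close> with
  \<open>x * x = e\<^sub>i\<^sub>k\<close> for distinct indices gives the cocycle identity \<open>c\<^sub>i\<^sub>k = c\<^sub>i\<^sub>j + c\<^sub>j\<^sub>k\<close>, so \<open>\<Delta>\<close> is the commutator
  with the diagonal matrix with entries \<open>c\<^sub>i\<^sub>0\<close>.
\<close>

section \<open>Commutators and their entries\<close>

definition commutator :: "'a :: comm_ring mat \<Rightarrow> 'a mat \<Rightarrow> 'a mat" where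
  "commutator a x = a * x - x * a"

lemma commutator_carrier [simp, intro]:
  "a \<in> carrier_mat n n \<Longrightarrow> x \<in> carrier_mat n n \<Longrightarrow> commutator a x \<in> carrier_mat n n"
  by (simp add: commutator_def minus_carrier_mat)

lemma index_mult_mat_sum:
  assumes "A \<in> carrier_mat n n" "B \<in> carrier_mat n n" "k < n" "l < n"
  shows "(A * B) $$ (k, l) = (\<Sum>p<n. A $$ (k, p) * B $$ (p, l))"
  using assms by (simp add: scalar_prod_def atLeast0LessThan)

lemma commutator_index:
  assumes "a \<in> carrier_mat n n" "x \<in> carrier_mat n n" "k < n" "l < n"
  shows "commutator a x $$ (k, l) =
    (\<Sum>p<n. a $$ (k, p) * x $$ (p, l)) - (\<Sum>p<n. x $$ (k, p) * a $$ (p, l))"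
  using assms
  by (simp add: commutator_def index_mult_mat_sum[of _ n] del: index_mult_mat(1))

lemma commutator_diff_left:
  assumes "a \<in> carrier_mat n n" "b \<in> carrier_mat n n" "x \<in> carrier_mat n n"
  shows "commutator (a - b) x = commutator a x - commutator b x"
  using assms
  by (auto intro!: eq_matI simp: commutator_index[of _ n] left_diff_distrib right_diff_distrib
      sum_subtractf minus_carrier_mat carrier_matD[OF commutator_carrier[of _ n]])

lemma commutator_add_left:
  assumes "a \<in> carrier_mat n n" "b \<in> carrier_mat n n" "x \<in> carrier_mat n n"
  shows "commutator (a + b) x = commutator a x + commutator b x"
  using assms
  by (auto intro!: eq_matI simp: commutator_index[of _ n] distrib_left distrib_right
      sum.distrib carrier_matD[OF commutator_carrier[of _ n]])

text \<open>The Leibniz rule on a square: expanding the right-hand side, the two terms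
  \<open>x * (a * x)\<close> cancel.\<close>

lemma commutator_square:
  assumes "a \<in> carrier_mat n n" "x \<in> carrier_mat n n"
  shows "commutator a (x * x) = commutator a x * x + x * commutator a x"
proof -
  have "commutator a x * x = a * (x * x) - x * (a * x)"
    using assms unfolding commutator_def
    by (subst minus_mult_distrib_mat[of _ n n]) (auto simp: assoc_mult_mat[of _ n n _ n _ n])
  moreover have "x * commutator a x = x * (a * x) - x * x * a"
    using assms unfolding commutator_def
    by (subst mult_minus_distrib_mat[of _ n n]) (auto simp: assoc_mult_mat[of _ n n _ n _ n])
  ultimately show ?thesis
    using assms by (auto intro!: eq_matI simp: commutator_def)
qed

definition mat_unit :: "nat \<Rightarrow> nat \<Rightarrow> nat \<Rightarrow> 'a :: {comm_ring, comm_monoid_mult} mat" where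
  "mat_unit n i j = mat n n (\<lambda>(k, l). if k = i \<and> l = j then 1 else 0)"

lemma mat_unit_carrier [simp, intro]: "mat_unit n i j \<in> carrier_mat n n"
  by (simp add: mat_unit_def)

lemma mat_unit_index:
  "k < n \<Longrightarrow> l < n \<Longrightarrow> mat_unit n i j $$ (k, l) = (if k = i \<and> l = j then 1 else 0)"
  by (simp add: mat_unit_def)

text \<open>Multiplying by the unit on the right moves column \<open>i\<close> of \<open>a\<close>
  into column \<open>j\<close>; on the left it moves row \<open>j\<close> into row \<open>i\<close>.
  Hence a commutator with a unit exposes one column and one row of \<open>a\<close>.\<close>

lemma commutator_mat_unit_index:
  assumes "a \<in> carrier_mat n n" "i < n" "j < n" "k < n" "l < n"
  shows "commutator a (mat_unit n i j) $$ (k, l) =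
    (if l = j then a $$ (k, i) else 0) - (if k = i then a $$ (j, l) else 0)"
proof -
  have "(\<Sum>p<n. a $$ (k, p) * mat_unit n i j $$ (p, l)) =
      (\<Sum>p<n. if p = i then (if l = j then a $$ (k, i) else 0) else 0)"
    using assms by (intro sum.cong) (auto simp: mat_unit_index)
  moreover have "(\<Sum>p<n. mat_unit n i j $$ (k, p) * a $$ (p, l)) =
      (\<Sum>p<n. if p = j then (if k = i then a $$ (j, l) else 0) else 0)"
    using assms by (intro sum.cong) (auto simp: mat_unit_index)
  ultimately show ?thesis
    using assms by (simp add: commutator_index[of _ n])
qed

section \<open>Reduction to maps vanishing on the diagonal units\<close>

definition pairwise_commutator ::
  "nat \<Rightarrow> ('a :: {comm_ring, comm_monoid_mult} mat \<Rightarrow> 'a mat) \<Rightarrow> bool" where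
  "pairwise_commutator n \<Delta> \<longleftrightarrow> (\<forall>x\<in>carrier_mat n n. \<forall>y\<in>carrier_mat n n.
     \<exists>a\<in>carrier_mat n n. \<Delta> x = commutator a x \<and> \<Delta> y = commutator a y)"

lemma pairwise_commutatorE:
  assumes "pairwise_commutator n \<Delta>" "x \<in> carrier_mat n n" "y \<in> carrier_mat n n"
  obtains a where "a \<in> carrier_mat n n" "\<Delta> x = commutator a x" "\<Delta> y = commutator a y"
  using assms unfolding pairwise_commutator_def by blast

lemma pairwise_commutator_carrier:
  "pairwise_commutator n \<Delta> \<Longrightarrow> x \<in> carrier_mat n n \<Longrightarrow> \<Delta> x \<in> carrier_mat n n"
  by (metis commutator_carrier pairwise_commutatorE)

text \<open>The commutator is additive in its left argument, so \<open>a - b\<close> serves whenever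
  \<open>a\<close> does, although \<Delta> itself need not be additive.\<close>

lemma pairwise_commutator_diff:
  fixes \<Delta> :: "'a :: {comm_ring, comm_monoid_mult} mat \<Rightarrow> 'a mat"
  assumes "pairwise_commutator n \<Delta>" "b \<in> carrier_mat n n"
  shows "pairwise_commutator n (\<lambda>x. \<Delta> x - commutator b x)"
  unfolding pairwise_commutator_def
proof (intro ballI)
  fix x y :: "'a mat"
  assume xy: "x \<in> carrier_mat n n" "y \<in> carrier_mat n n"
  obtain a where "a \<in> carrier_mat n n" "\<Delta> x = commutator a x" "\<Delta> y = commutator a y"
    using pairwise_commutatorE[OF assms(1) xy] .
  then show "\<exists>a\<in>carrier_mat n n. \<Delta> x - commutator b x = commutator a x \<and>
      \<Delta> y - commutator b y = commutator a y"
    using assms(2) xy by (intro bexI[of _ "a - b"])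
      (simp_all add: commutator_diff_left minus_carrier_mat)
qed

lemma pairwise_commutator_diagonal_units:
  fixes \<Delta> :: "'a :: {comm_ring, comm_monoid_mult} mat \<Rightarrow> 'a mat"
  assumes \<Delta>: "pairwise_commutator n \<Delta>"
  obtains b where "b \<in> carrier_mat n n"
    "\<And>i. i < n \<Longrightarrow> \<Delta> (mat_unit n i i) = commutator b (mat_unit n i i)"
proof
  \<comment> \<open>Column \<open>i\<close> of any \<open>a\<close> that represents \<Delta> at the
    \<open>i\<close>-th diagonal unit is determined off the diagonal; \<open>b\<close> collects
    these columns.\<close>
  define b where "b = mat n n (\<lambda>(k, i). \<Delta> (mat_unit n i i) $$ (k, i))"
  show b: "b \<in> carrier_mat n n"
    by (simp add: b_def)
  show "\<Delta> (mat_unit n i i) = commutator b (mat_unit n i i)" if i: "i < n" for i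
  proof (rule eq_matI)
    fix k l
    assume "k < dim_row (commutator b (mat_unit n i i))"
      and "l < dim_col (commutator b (mat_unit n i i))"
    then have k: "k < n" and l: "l < n"
      using carrier_matD[OF commutator_carrier[OF b mat_unit_carrier]] by auto
    \<comment> \<open>Column \<open>i\<close> agrees by construction. Row \<open>i\<close> involves
      \<open>b $$ (i, l)\<close>, which was read off from the \<open>l\<close>-th diagonal unit, so
      one \<open>a\<close> must serve both units.\<close>
    obtain a where a: "a \<in> carrier_mat n n"
      "\<Delta> (mat_unit n i i) = commutator a (mat_unit n i i)"
      "\<Delta> (mat_unit n l l) = commutator a (mat_unit n l l)"
      using pairwise_commutatorE[OF \<Delta> mat_unit_carrier mat_unit_carrier] .
    show "\<Delta> (mat_unit n i i) $$ (k, l) = commutator b (mat_unit n i i) $$ (k, l)"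
      using i k l a b by (simp add: commutator_mat_unit_index b_def)
  qed (use pairwise_commutator_carrier[OF \<Delta> mat_unit_carrier]
      carrier_matD[OF commutator_carrier[OF b mat_unit_carrier]] in auto)
qed

section \<open>The normalised map acts entrywise\<close>

context
  fixes n :: nat and \<Delta> :: "'a :: {comm_ring, comm_monoid_mult} mat \<Rightarrow> 'a mat"
  assumes \<Delta>: "pairwise_commutator n \<Delta>"
    and diag: "\<And>i. i < n \<Longrightarrow> \<Delta> (mat_unit n i i) = 0\<^sub>m n n"
begin

text \<open>A representing \<open>a\<close> that commutes with the \<open>i\<close>-th diagonal unit
  has column \<open>i\<close> zero off the diagonal; one that commutes with the \<open>j\<close>-th
  has row \<open>j\<close> zero off the diagonal. The two cases remove the entries outside row
  \<open>i\<close> and the remaining ones in row \<open>i\<close>.\<close>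

lemma mat_unit_eigen_index:
  assumes ij: "i < n" "j < n" and kl: "k < n" "l < n" and ne: "(k, l) \<noteq> (i, j)"
  shows "\<Delta> (mat_unit n i j) $$ (k, l) = 0"
proof (cases "k = i")
  case False
  obtain a where a: "a \<in> carrier_mat n n"
    "\<Delta> (mat_unit n i j) = commutator a (mat_unit n i j)"
    "\<Delta> (mat_unit n i i) = commutator a (mat_unit n i i)"
    using pairwise_commutatorE[OF \<Delta> mat_unit_carrier mat_unit_carrier] .
  have "commutator a (mat_unit n i i) $$ (k, i) = 0"
    using a diag ij kl by (metis index_zero_mat(1))
  then show ?thesis
    using a ij kl False by (simp add: commutator_mat_unit_index)
next
  case True
  then have l: "l \<noteq> j"
    using ne by simp
  obtain a where a: "a \<in> carrier_mat n n"
    "\<Delta> (mat_unit n i j) = commutator a (mat_unit n i j)"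
    "\<Delta> (mat_unit n j j) = commutator a (mat_unit n j j)"
    using pairwise_commutatorE[OF \<Delta> mat_unit_carrier mat_unit_carrier] .
  have "commutator a (mat_unit n j j) $$ (j, l) = 0"
    using a diag ij kl by (metis index_zero_mat(1))
  then show ?thesis
    using a ij kl l by (simp add: commutator_mat_unit_index)
qed

definition weight :: "nat \<Rightarrow> nat \<Rightarrow> 'a" where
  "weight i j = \<Delta> (mat_unit n i j) $$ (i, j)"

lemma weight_self: "i < n \<Longrightarrow> weight i i = 0"
  by (simp add: weight_def diag)

text \<open>The transposed unit is the right partner for \<open>x\<close>: its commutator with
  \<open>a\<close> exposes column \<open>l\<close> and row \<open>k\<close> of \<open>a\<close>,
  exactly what entry \<open>(k, l)\<close> of \<open>commutator a x\<close> uses. Their off-diagonal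
  entries vanish, which leaves the factor \<open>a $$ (k, k) - a $$ (l, l)\<close>.\<close>

lemma index_neg_weight:
  assumes x: "x \<in> carrier_mat n n" and kl: "k < n" "l < n"
  shows "\<Delta> x $$ (k, l) = - weight l k * x $$ (k, l)"
proof -
  obtain a where a: "a \<in> carrier_mat n n"
    "\<Delta> x = commutator a x" "\<Delta> (mat_unit n l k) = commutator a (mat_unit n l k)"
    using pairwise_commutatorE[OF \<Delta> x mat_unit_carrier] .
  have col: "a $$ (p, l) = 0" if "p < n" "p \<noteq> l" for p
    using mat_unit_eigen_index[of l k p k] that a kl
    by (simp add: commutator_mat_unit_index)
  have row: "a $$ (k, p) = 0" if "p < n" "p \<noteq> k" for p
    using mat_unit_eigen_index[of l k l p] that a kl
    by (simp add: commutator_mat_unit_index)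
  have w: "weight l k = a $$ (l, l) - a $$ (k, k)"
    using a kl by (simp add: weight_def commutator_mat_unit_index)
  have "(\<Sum>p<n. a $$ (k, p) * x $$ (p, l)) = (\<Sum>p<n. if p = k then a $$ (k, k) * x $$ (k, l) else 0)"
    by (intro sum.cong) (auto simp: row)
  moreover have "(\<Sum>p<n. x $$ (k, p) * a $$ (p, l)) =
      (\<Sum>p<n. if p = l then x $$ (k, l) * a $$ (l, l) else 0)"
    by (intro sum.cong) (auto simp: col)
  ultimately show ?thesis
    using a x kl by (simp add: commutator_index[of _ n] w algebra_simps)
qed

text \<open>Taking a matrix unit for \<open>x\<close> evaluates its own weight through the
  transposed one.\<close>

lemma weight_skew: "i < n \<Longrightarrow> j < n \<Longrightarrow> weight j i = - weight i j"
  using index_neg_weight[of "mat_unit n j i" j i] by (simp add: weight_def mat_unit_index)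

lemma index_weight:
  assumes "x \<in> carrier_mat n n" "k < n" "l < n"
  shows "\<Delta> x $$ (k, l) = weight k l * x $$ (k, l)"
  using index_neg_weight[OF assms] weight_skew[OF assms(2,3)] by simp

lemma weight_cocycle:
  assumes ijk: "i < n" "j < n" "k < n"
  shows "weight i k = weight i j + weight j k"
proof (cases "i = j \<or> j = k \<or> i = k")
  case True
  then show ?thesis
    using ijk weight_self weight_skew[of i j] by auto
next
  case False
  define x :: "'a mat" where "x = mat_unit n i j + mat_unit n j k"
  have x: "x \<in> carrier_mat n n"
    by (auto simp: x_def)
  have xi: "x $$ (i, p) = (if p = j then 1 else 0)"
    and xk: "x $$ (p, k) = (if p = j then 1 else 0)" if "p < n" for p
    using that ijk False carrier_matD[OF mat_unit_carrier[of n j k, where 'a='a]]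
    by (auto simp: x_def mat_unit_index)
  obtain a where "a \<in> carrier_mat n n" "\<Delta> x = commutator a x" "\<Delta> (x * x) = commutator a (x * x)"
    using pairwise_commutatorE[OF \<Delta> x mult_carrier_mat[OF x x]] .
  \<comment> \<open>A single \<open>a\<close> serves \<open>x\<close> and \<open>x * x\<close>, so
    \<Delta> inherits the Leibniz rule here.\<close>
  then have sq: "\<Delta> (x * x) = \<Delta> x * x + x * \<Delta> x"
    using commutator_square x by simp
  have \<Delta>x: "\<Delta> x \<in> carrier_mat n n"
    using pairwise_commutator_carrier[OF \<Delta> x] .
  \<comment> \<open>Row \<open>i\<close> and column \<open>k\<close> of \<open>x\<close> are
    supported at index \<open>j\<close>, so each of the three sums has one surviving term.\<close>
  have "(x * x) $$ (i, k) = (\<Sum>p<n. if p = j then 1 else 0)"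
    unfolding index_mult_mat_sum[OF x x ijk(1,3)] by (intro sum.cong) (auto simp: xi xk)
  moreover have "(\<Delta> x * x) $$ (i, k) = (\<Sum>p<n. if p = j then weight i j else 0)"
    unfolding index_mult_mat_sum[OF \<Delta>x x ijk(1,3)]
    using ijk x by (intro sum.cong) (auto simp: index_weight xi xk)
  moreover have "(x * \<Delta> x) $$ (i, k) = (\<Sum>p<n. if p = j then weight j k else 0)"
    unfolding index_mult_mat_sum[OF x \<Delta>x ijk(1,3)]
    using ijk x by (intro sum.cong) (auto simp: index_weight xi xk)
  moreover have "\<Delta> (x * x) $$ (i, k) = (\<Delta> x * x) $$ (i, k) + (x * \<Delta> x) $$ (i, k)"
    unfolding sq using ijk x \<Delta>x by (subst index_add_mat(1)) auto
  ultimately show ?thesis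
    using ijk index_weight[OF mult_carrier_mat[OF x x], of i k] by simp
qed

lemma commutator_diagonal:
  obtains d where "d \<in> carrier_mat n n"
    "\<And>x. x \<in> carrier_mat n n \<Longrightarrow> \<Delta> x = commutator d x"
proof
  define d where "d = mat n n (\<lambda>(i, j). if i = j then weight i 0 else 0)"
  show d: "d \<in> carrier_mat n n"
    by (simp add: d_def)
  show "\<Delta> x = commutator d x" if x: "x \<in> carrier_mat n n" for x
  proof (rule eq_matI)
    fix k l
    assume "k < dim_row (commutator d x)" "l < dim_col (commutator d x)"
    then have kl: "k < n" "l < n"
      using carrier_matD[OF commutator_carrier[OF d x]] by auto
    have "(\<Sum>p<n. d $$ (k, p) * x $$ (p, l)) = (\<Sum>p<n. if p = k then weight k 0 * x $$ (k, l) else 0)"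
      using kl by (intro sum.cong) (auto simp: d_def)
    moreover have "(\<Sum>p<n. x $$ (k, p) * d $$ (p, l)) =
        (\<Sum>p<n. if p = l then x $$ (k, l) * weight l 0 else 0)"
      using kl by (intro sum.cong) (auto simp: d_def)
    \<comment> \<open>The cocycle identity is routed through the base index 0, which is in range
      because \<open>k < n\<close>; skewness turns \<open>weight 0 l\<close> into
      \<open>- weight l 0\<close>.\<close>
    moreover have "weight k l = weight k 0 - weight l 0"
      using weight_cocycle[of k 0 l] weight_skew[of l 0] kl by simp
    ultimately show "\<Delta> x $$ (k, l) = commutator d x $$ (k, l)"
      using d x kl by (simp add: commutator_index[of _ n] index_weight left_diff_distrib right_diff_distrib mult.commute)
  qed (use pairwise_commutator_carrier[OF \<Delta> x] carrier_matD[OF commutator_carrier[OF d x]] in auto)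
qed

end

section \<open>Undoing the normalisation and returning to the matrix ring\<close>

lemma pairwise_commutator_imp_commutator:
  assumes \<Delta>: "pairwise_commutator n \<Delta>"
  obtains a where "a \<in> carrier_mat n n"
    "\<And>x. x \<in> carrier_mat n n \<Longrightarrow> \<Delta> x = commutator a x"
proof -
  obtain b where b: "b \<in> carrier_mat n n"
    "\<And>i. i < n \<Longrightarrow> \<Delta> (mat_unit n i i) = commutator b (mat_unit n i i)"
    using pairwise_commutator_diagonal_units[OF \<Delta>] by blast
  have zero: "\<Delta> (mat_unit n i i) - commutator b (mat_unit n i i) = 0\<^sub>m n n" if "i < n" for i
    using b that by (simp add: minus_r_inv_mat[of _ n n])
  obtain d where d: "d \<in> carrier_mat n n"
    "\<And>x. x \<in> carrier_mat n n \<Longrightarrow> \<Delta> x - commutator b x = commutator d x"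
    using commutator_diagonal[OF pairwise_commutator_diff[OF \<Delta> b(1)] zero] by blast
  show thesis
  proof
    show "b + d \<in> carrier_mat n n"
      using b d by simp
    show "\<Delta> x = commutator (b + d) x" if x: "x \<in> carrier_mat n n" for x
    proof -
      have "commutator b x + (\<Delta> x - commutator b x) = \<Delta> x"
        using pairwise_commutator_carrier[OF \<Delta> x] commutator_carrier[OF b(1) x]
        by (auto intro!: eq_matI)
      then show ?thesis
        using b(1) d x by (simp add: commutator_add_left)
    qed
  qed
qed

lemma matrix_ring_commutator:
  assumes "a \<in> carrier_mat n n" "x \<in> carrier_mat n n"
  shows "a \<otimes>\<^bsub>matrix_ring n\<^esub> x \<ominus>\<^bsub>matrix_ring n\<^esub> x \<otimes>\<^bsub>matrix_ring n\<^esub> a = commutator a x"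
  using assms by (simp add: matrix_ring_simps matrix_ring_minus commutator_def)

theorem theorem2p4:
  fixes n :: nat
    and \<Delta> :: "'a :: {comm_ring, comm_monoid_mult} mat \<Rightarrow> 'a mat"
  assumes "(1 + 1 :: 'a) dvd 1"
    and "n > 1"
    and "two_local_inner_derivation (matrix_ring n) \<Delta>"
  shows "inner_derivation (matrix_ring n) \<Delta>"
proof -
  have "pairwise_commutator n \<Delta>"
    using assms(3) unfolding two_local_inner_derivation_def pairwise_commutator_def
    by (simp add: matrix_ring_simps(1) matrix_ring_commutator cong: bex_cong)
  then obtain a where "a \<in> carrier_mat n n"
    "\<And>x. x \<in> carrier_mat n n \<Longrightarrow> \<Delta> x = commutator a x"
    using pairwise_commutator_imp_commutator by blast
  then show ?thesis
    using assms(3) unfolding two_local_inner_derivation_def inner_derivation_def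
    by (auto simp: matrix_ring_simps(1) matrix_ring_commutator)
qed

end
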